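(* Let $K$ be an algebraically closed field of characteristic zero. If $X_1,\ldots,X_s \subseteq \mathbb{A}_K^N$ are irreducible affine cones, then \[ M(X_1+\cdots+X_s) \preceq M(X_1)\vee\cdots\vee M(X_s). \]
   Context: An affine cone $X \subseteq \mathbb{A}^N$ is a variety whose vanishing ideal $\mathcal{I}(X)\subseteq K[z_1,\ldots,z_N]$ is homogeneous. The (embedded) join of irreducible affine cones is $X_1+\cdots+X_s = \overline{\{x_1+\cdots+x_s : x_i \in X_i\}}$ (Zariski closure). For an irreducible variety $X\subseteq\mathbb{A}^N$, the algebraic matroid $M(X)$ has ground set $Z=\{z_1,\ldots,z_N\}$, and $E\subseteq Z$ is independent iff $\mathcal{I}(X)\cap K[E]=\langle 0\rangle$. For matroids $M_1,\ldots,M_s$ on ground sets $E_1,\ldots,E_s$, the matroid union $M_1\vee\cdots\vee M_s$ is the matroid on $E_1\cup\cdots\cup E_s$ whose independent sets are the sets $I_1\cup\cdots\cup I_s$ with each $I_i$ independent in $M_i$. For matroids $M, M'$ on a common ground set, $M\preceq M'$ (weak order) means every dependent set of $M'$ is dependent in $M$. *)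

theory Defs
  imports
    "HOL-Analysis.Analysis"
    "HOL-Library.Poly_Mapping"
    "HOL-Computational_Algebra.Polynomial"
begin

section \<open>Polynomials in finitely many variables\<close>

text \<open>
  The coordinates of affine space are indexed by a finite type \<open>'n\<close>, so that
  $N = $ \<open>CARD('n)\<close>, and the variable $z_i$ is identified with its index \<open>i\<close>.
  A polynomial maps exponent vectors to coefficients; its ring structure is the
  convolution product of \<open>Poly_Mapping\<close>.
\<close>

type_synonym ('n, 'a) mpoly = "('n \<Rightarrow>\<^sub>0 nat) \<Rightarrow>\<^sub>0 'a"

definition eval_mpoly :: "('n::finite, 'a::comm_ring_1) mpoly \<Rightarrow> 'a ^ 'n \<Rightarrow> 'a" where
  "eval_mpoly f x =
     (\<Sum>m\<in>Poly_Mapping.keys f. Poly_Mapping.lookup f m * (\<Prod>i\<in>UNIV. (x $ i) ^ Poly_Mapping.lookup m i))"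

definition monom_degree :: "('n::finite \<Rightarrow>\<^sub>0 nat) \<Rightarrow> nat" where
  "monom_degree m = (\<Sum>i\<in>UNIV. Poly_Mapping.lookup m i)"

definition homogeneous_component :: "nat \<Rightarrow> ('n::finite, 'a::comm_ring_1) mpoly \<Rightarrow> ('n, 'a) mpoly" where
  "homogeneous_component d f =
     (\<Sum>m\<in>{m \<in> Poly_Mapping.keys f. monom_degree m = d}. Poly_Mapping.single m (Poly_Mapping.lookup f m))"

text \<open>The predicate is only meant for sets \<open>I\<close> that are ideals.\<close>

definition homogeneous_ideal :: "('n::finite, 'a::comm_ring_1) mpoly set \<Rightarrow> bool" where
  "homogeneous_ideal I \<longleftrightarrow> (\<forall>f\<in>I. \<forall>d. homogeneous_component d f \<in> I)"

definition polys_in :: "'n set \<Rightarrow> ('n::finite, 'a::comm_ring_1) mpoly set" where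
  "polys_in E = {f. \<forall>m\<in>Poly_Mapping.keys f. Poly_Mapping.keys m \<subseteq> E}"


section \<open>Affine varieties\<close>

definition zero_locus :: "('n::finite, 'a::comm_ring_1) mpoly set \<Rightarrow> ('a ^ 'n) set" where
  "zero_locus F = {x. \<forall>f\<in>F. eval_mpoly f x = 0}"

definition vanishing_ideal :: "('a::comm_ring_1 ^ 'n::finite) set \<Rightarrow> ('n, 'a) mpoly set" where
  "vanishing_ideal X = {f. \<forall>x\<in>X. eval_mpoly f x = 0}"

definition zariski_closed :: "('a::comm_ring_1 ^ 'n::finite) set \<Rightarrow> bool" where
  "zariski_closed X \<longleftrightarrow> (\<exists>F. X = zero_locus F)"

lemma zariski_closed_Inter:
  assumes "\<And>X. X \<in> \<X> \<Longrightarrow> zariski_closed X"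
  shows "zariski_closed (\<Inter>\<X>)"
proof -
  obtain F where "\<And>X. X \<in> \<X> \<Longrightarrow> X = zero_locus (F X)"
    using assms unfolding zariski_closed_def by metis
  then have "\<Inter>\<X> = zero_locus (\<Union>X\<in>\<X>. F X)"
    unfolding zero_locus_def by blast
  then show ?thesis
    unfolding zariski_closed_def by blast
qed

abbreviation zariski_closure :: "('a::comm_ring_1 ^ 'n::finite) set \<Rightarrow> ('a ^ 'n) set" where
  "zariski_closure S \<equiv> zariski_closed hull S"

lemma zariski_closed_closure: "zariski_closed (zariski_closure S)"
  by (rule hull_in) (use zariski_closed_Inter in blast)

definition irreducible_variety :: "('a::comm_ring_1 ^ 'n::finite) set \<Rightarrow> bool" where
  "irreducible_variety X \<longleftrightarrow> zariski_closed X \<and> X \<noteq> {} \<and>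
     (\<forall>A B. zariski_closed A \<longrightarrow> zariski_closed B \<longrightarrow> X = A \<union> B \<longrightarrow> X = A \<or> X = B)"

definition affine_cone :: "('a::comm_ring_1 ^ 'n::finite) set \<Rightarrow> bool" where
  "affine_cone X \<longleftrightarrow> zariski_closed X \<and> homogeneous_ideal (vanishing_ideal X)"

definition join_cones :: "nat \<Rightarrow> (nat \<Rightarrow> ('a::comm_ring_1 ^ 'n::finite) set) \<Rightarrow> ('a ^ 'n) set" where
  "join_cones s X = zariski_closure {\<Sum>i=1..s. x i | x. \<forall>i\<in>{1..s}. x i \<in> X i}"


section \<open>Matroids\<close>

text \<open>
  A matroid is represented by its data, a ground set and a family of independent sets;
  the matroid axioms are not part of the type.
\<close>

record 'e matroid =
  ground :: "'e set"
  indeps :: "'e set set"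

definition dependents :: "'e matroid \<Rightarrow> 'e set set" where
  "dependents M = Pow (ground M) - indeps M"

definition weak_le :: "'e matroid \<Rightarrow> 'e matroid \<Rightarrow> bool"  (infix \<open>\<preceq>\<^sub>w\<close> 50) where
  "M \<preceq>\<^sub>w M' \<longleftrightarrow> ground M = ground M' \<and> dependents M' \<subseteq> dependents M"

definition matroid_union :: "nat \<Rightarrow> (nat \<Rightarrow> 'e matroid) \<Rightarrow> 'e matroid" where
  "matroid_union s M =
     \<lparr>ground = (\<Union>i\<in>{1..s}. ground (M i)),
      indeps = {\<Union>i\<in>{1..s}. I i | I. \<forall>i\<in>{1..s}. I i \<in> indeps (M i)}\<rparr>"

definition algebraic_matroid :: "('a::comm_ring_1 ^ 'n::finite) set \<Rightarrow> 'n matroid" where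
  "algebraic_matroid X =
     \<lparr>ground = UNIV, indeps = {E. vanishing_ideal X \<inter> polys_in E = {0}}\<rparr>"

end

theory Submission
  imports Defs "HOL-Library.Function_Algebras"
begin

text \<open>
  For a set \<open>A\<close> of coordinates, let \<open>H(X, A, d)\<close> be the dimension of the space of functions on \<open>X\<close> given
  by polynomials in the variables \<open>A\<close> of degree at most \<open>d\<close> in each variable. If \<open>A\<close> is independent in
  \<open>X\<close>, this is \<open>(d + 1) ^ |A|\<close>; if \<open>X\<close> is irreducible and \<open>I\<close> is a maximal independent subset of \<open>A\<close>,
  it is \<open>O((d + 1) ^ |I|)\<close>. Comparing the two bounds gives the exchange axiom, so that \<open>H(X, A, d)\<close>
  grows no faster than \<open>d\<close> to the rank of \<open>A\<close>.
  Since the monomials of \<open>x + y\<close> expand into products of monomials of \<open>x\<close> and of \<open>y\<close>, \<open>H\<close> is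
  submultiplicative under sums of sets. Hence a set \<open>E\<close> independent in the join satisfies
  \<open>|A| \<le> r\<^sub>1(A) + \<dots> + r\<^sub>s(A)\<close> for all \<open>A \<subseteq> E\<close>, and by the matroid union theorem \<open>E\<close> is a union of
  sets independent in the single varieties.
\<close>

section \<open>Matroid ranks and partitions\<close>

text \<open>The matroid record carries no axioms, so the independence axioms are collected here, to
  be instantiated with \<open>alg_indep (X i)\<close>.\<close>

locale matroid_indep =
  fixes ind :: "'e::finite set \<Rightarrow> bool"
  assumes ind_empty: "ind {}"
    and ind_subset: "ind J \<Longrightarrow> I \<subseteq> J \<Longrightarrow> ind I"
    and augment: "ind I \<Longrightarrow> ind J \<Longrightarrow> card I < card J \<Longrightarrow> \<exists>e\<in>J - I. ind (insert e I)"
begin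

definition rk :: "'e set \<Rightarrow> nat" where
  "rk A = Max (card ` {I. I \<subseteq> A \<and> ind I})"

lemma card_le_rk: "I \<subseteq> A \<Longrightarrow> ind I \<Longrightarrow> card I \<le> rk A"
  unfolding rk_def by (rule Max_ge) auto

lemma rk_attained:
  obtains I where "I \<subseteq> A" "ind I" "card I = rk A"
proof -
  have "rk A \<in> card ` {I. I \<subseteq> A \<and> ind I}"
    unfolding rk_def by (rule Max_in) (use ind_empty in auto)
  then show thesis using that by auto
qed

lemma rk_mono: "A \<subseteq> B \<Longrightarrow> rk A \<le> rk B"
  by (metis rk_attained card_le_rk subset_trans)

lemma rk_le_card: "rk A \<le> card A"
  by (metis rk_attained card_mono finite)

lemma ind_if_rk_eq_card: "rk A = card A \<Longrightarrow> ind A"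
  by (metis rk_attained card_subset_eq finite)

text \<open>A largest independent set between \<open>I\<close> and \<open>A\<close> reaches the
  rank: otherwise augmentation from a bigger independent subset of \<open>A\<close> would enlarge it
  inside \<open>A\<close>.\<close>

lemma extend_to_rk:
  assumes "ind I" "I \<subseteq> A"
  obtains J where "I \<subseteq> J" "J \<subseteq> A" "ind J" "card J = rk A"
proof -
  let ?C = "{J. I \<subseteq> J \<and> J \<subseteq> A \<and> ind J}"
  have "Max (card ` ?C) \<in> card ` ?C"
    by (rule Max_in) (use assms in auto)
  then obtain J where J: "J \<in> ?C" and max: "card J = Max (card ` ?C)"
    by force
  have "rk A \<le> card J"
  proof (rule ccontr)
    assume "\<not> ?thesis"
    then obtain K where K: "K \<subseteq> A" "ind K" "card J < card K"
      by (metis not_le rk_attained)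
    then obtain e where e: "e \<in> K - J" "ind (insert e J)"
      using augment J by blast
    then have "card (insert e J) \<le> Max (card ` ?C)"
      using J K by (intro Max_ge imageI) auto
    then show False
      using e max by simp
  qed
  then have "card J = rk A"
    using J card_le_rk by (simp add: le_antisym)
  then show thesis using J that by blast
qed

text \<open>Extend a basis \<open>I\<close> of the intersection to a basis \<open>J\<close> of the
  union. Then \<open>J\<close> has at least \<open>card I\<close> elements in
  \<open>A \<inter> B\<close>, both \<open>J \<inter> A\<close> and \<open>J \<inter> B\<close> are
  independent, and inclusion-exclusion for \<open>J\<close> concludes.\<close>

lemma rk_submodular: "rk (A \<union> B) + rk (A \<inter> B) \<le> rk A + rk B"
proof -
  obtain I where I: "I \<subseteq> A \<inter> B" "ind I" "card I = rk (A \<inter> B)"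
    by (rule rk_attained)
  obtain J where J: "I \<subseteq> J" "J \<subseteq> A \<union> B" "ind J" "card J = rk (A \<union> B)"
    using extend_to_rk[of I "A \<union> B"] I by blast
  have "card J + card I \<le> card J + card (J \<inter> A \<inter> B)"
    using I J by (intro add_left_mono card_mono) auto
  also have "\<dots> = card (J \<inter> A) + card (J \<inter> B)"
  proof -
    have "(J \<inter> A) \<union> (J \<inter> B) = J" "(J \<inter> A) \<inter> (J \<inter> B) = J \<inter> A \<inter> B"
      using J by auto
    then show ?thesis
      using card_Un_Int[of "J \<inter> A" "J \<inter> B"] by simp
  qed
  also have "\<dots> \<le> rk A + rk B"
    using J ind_subset by (intro add_mono card_le_rk) auto
  finally show ?thesis using I J by simp
qed

end

text \<open>Rado's argument: as long as some element may still go to two different parts, submodularity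
  shows that one of the two options can be discarded without violating the rank condition.\<close>

lemma matroid_partition:
  fixes r :: "'i \<Rightarrow> 'e::finite set \<Rightarrow> nat" and S :: "'e \<Rightarrow> 'i set"
  assumes "finite N"
    and mono: "\<And>i A B. i \<in> N \<Longrightarrow> A \<subseteq> B \<Longrightarrow> r i A \<le> r i B"
    and submod: "\<And>i A B. i \<in> N \<Longrightarrow> r i (A \<union> B) + r i (A \<inter> B) \<le> r i A + r i B"
    and le_card: "\<And>i A. i \<in> N \<Longrightarrow> r i A \<le> card A"
    and "\<And>e. S e \<subseteq> N"
    and "\<And>A. A \<subseteq> E \<Longrightarrow> card A \<le> (\<Sum>i\<in>N. r i {e \<in> A. i \<in> S e})"
  shows "\<exists>I. (\<forall>i\<in>N. r i (I i) = card (I i)) \<and> (\<Union>i\<in>N. I i) = E"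
  using assms(5,6)
proof (induction "\<Sum>e\<in>UNIV. card (S e)" arbitrary: S rule: less_induct)
  case less
  note S = less.prems(1) and rado = less.prems(2)
  have fin [simp]: "finite (S e)" for e
    using S \<open>finite N\<close> finite_subset by blast
  show ?case
  proof (cases "\<exists>e\<in>E. \<exists>x\<in>S e. \<exists>y\<in>S e. x \<noteq> y")
    case False
    have SN: "i \<in> N" if "i \<in> S e" for i e
      using S that by blast
    \<comment> \<open>No element of \<open>E\<close> has two options left, so the cardinalities of
      the \<open>I i\<close> add up to at most \<open>card E\<close>. With the rank condition for
      \<open>E\<close> and rank bounded by cardinality, all these estimates become
      equalities.\<close>
    define I where "I i = {e \<in> E. i \<in> S e}" for i
    have le1: "card (S e) \<le> 1" if "e \<in> E" for e
      using False that by (auto simp: card_le_Suc0_iff_eq)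
    have "(\<Sum>i\<in>N. card (I i)) = card (Sigma N I)"
      using \<open>finite N\<close> by simp
    also have "\<dots> = card (Sigma E S)"
      by (rule bij_betw_same_card[of prod.swap], rule bij_betwI[of _ _ _ prod.swap])
        (auto simp: I_def intro: SN)
    also have "\<dots> = (\<Sum>e\<in>E. card (S e))"
      by simp
    also have "\<dots> \<le> card E"
      using sum_bounded_above[of E "\<lambda>e. card (S e)" 1] le1 by simp
    also have "\<dots> \<le> (\<Sum>i\<in>N. r i (I i))"
      using rado[of E] by (simp add: I_def)
    finally have "(\<Sum>i\<in>N. card (I i)) \<le> (\<Sum>i\<in>N. r i (I i))" .
    moreover have "(\<Sum>i\<in>N. r i (I i)) \<le> (\<Sum>i\<in>N. card (I i))"
      by (rule sum_mono) (rule le_card)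
    ultimately have eq: "(\<Sum>i\<in>N. r i (I i)) = (\<Sum>i\<in>N. card (I i))"
      by simp
    have "r i (I i) = card (I i)" if "i \<in> N" for i
      by (rule sum_mono_inv[OF eq le_card that \<open>finite N\<close>])
    moreover have "(\<Union>i\<in>N. I i) = E"
    proof
      show "E \<subseteq> (\<Union>i\<in>N. I i)"
      proof
        fix e assume "e \<in> E"
        then have "1 \<le> (\<Sum>i\<in>N. r i {a \<in> {e}. i \<in> S a})"
          using rado[of "{e}"] by simp
        then obtain i where i: "i \<in> N" "r i {a \<in> {e}. i \<in> S a} \<noteq> 0"
          by (metis (no_types, lifting) not_one_le_zero sum.neutral)
        then have "{a \<in> {e}. i \<in> S a} \<noteq> {}"
          using le_card by (metis card.empty le_zero_eq)
        then show "e \<in> (\<Union>i\<in>N. I i)"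
          using i \<open>e \<in> E\<close> by (auto simp: I_def)
      qed
    qed (auto simp: I_def)
    ultimately show ?thesis by blast
  next
    case True
    then obtain e x y where e: "e \<in> E" and x: "x \<in> S e" and y: "y \<in> S e" and "x \<noteq> y"
      by blast
    define S1 where "S1 = S(e := S e - {x})"
    define S2 where "S2 = S(e := S e - {y})"
    have smaller: "(\<Sum>a\<in>UNIV. card ((S(e := S e - {z})) a)) < (\<Sum>a\<in>UNIV. card (S a))"
      if "z \<in> S e" for z
      using that by (intro sum_strict_mono_ex1) (auto intro!: diff_less card_gt_0_iff[THEN iffD2])
    have step: ?thesis if "S' = S(e := S e - {z})" "z \<in> S e"
      "\<And>A. A \<subseteq> E \<Longrightarrow> card A \<le> (\<Sum>i\<in>N. r i {a \<in> A. i \<in> S' a})" for S' z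
    proof (rule less.hyps[of S'])
      show "(\<Sum>a\<in>UNIV. card (S' a)) < (\<Sum>a\<in>UNIV. card (S a))"
        using smaller that by simp
      show "S' a \<subseteq> N" for a
        using S that(1) by (cases "a = e") auto
    qed (rule that(3))
    show ?thesis
    proof (rule ccontr)
      assume no: "\<not> ?thesis"
      \<comment> \<open>If no partition exists, the induction hypothesis cannot apply after deleting
        an option of \<open>e\<close>; hence each deletion breaks the rank condition on some subset
        of \<open>E\<close>.\<close>
      have violated: "\<exists>A\<subseteq>E. (\<Sum>i\<in>N. r i {a \<in> A. i \<in> (S(e := S e - {z})) a}) < card A"
        if "z \<in> S e" for z
        using step[OF refl that] no by (meson not_le)
      obtain A where A: "A \<subseteq> E" "(\<Sum>i\<in>N. r i {a \<in> A. i \<in> S1 a}) < card A"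
        using violated[OF x] unfolding S1_def by blast
      obtain B where B: "B \<subseteq> E" "(\<Sum>i\<in>N. r i {a \<in> B. i \<in> S2 a}) < card B"
        using violated[OF y] unfolding S2_def by blast
      \<comment> \<open>\<open>S1\<close> and \<open>S\<close> differ only at \<open>e\<close>, so a
        set avoiding \<open>e\<close> cannot violate the condition.\<close>
      have "e \<in> A"
      proof (rule ccontr)
        assume "e \<notin> A"
        then have "{a \<in> A. i \<in> S1 a} = {a \<in> A. i \<in> S a}" for i
          by (auto simp: S1_def)
        then show False using A rado[of A] by simp
      qed
      have "e \<in> B"
      proof (rule ccontr)
        assume "e \<notin> B"
        then have "{a \<in> B. i \<in> S2 a} = {a \<in> B. i \<in> S a}" for i
          by (auto simp: S2_def)
        then show False using B rado[of B] by simp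
      qed
      \<comment> \<open>The two strict violations leave a total gap of 2, whereas removing
        \<open>e\<close> from the intersection costs only 1.\<close>
      have "card (A \<union> B) + card (A \<inter> B - {e})
          \<le> (\<Sum>i\<in>N. r i {a \<in> A \<union> B. i \<in> S a}) + (\<Sum>i\<in>N. r i {a \<in> A \<inter> B - {e}. i \<in> S a})"
        using A B by (intro add_mono rado) auto
      also have "\<dots> \<le> (\<Sum>i\<in>N. r i {a \<in> A. i \<in> S1 a} + r i {a \<in> B. i \<in> S2 a})"
        unfolding sum.distrib[symmetric]
      proof (rule sum_mono)
        fix i assume i: "i \<in> N"
        \<comment> \<open>At \<open>e\<close> the first set loses only option \<open>x\<close> and
          the second only \<open>y\<close>; as \<open>x \<noteq> y\<close>, every option of
          \<open>e\<close> survives in one of them.\<close>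
        have un: "{a \<in> A \<union> B. i \<in> S a} = {a \<in> A. i \<in> S1 a} \<union> {a \<in> B. i \<in> S2 a}"
          using \<open>e \<in> A\<close> \<open>e \<in> B\<close> x y \<open>x \<noteq> y\<close> by (auto simp: S1_def S2_def)
        have "{a \<in> A \<inter> B - {e}. i \<in> S a} \<subseteq> {a \<in> A. i \<in> S1 a} \<inter> {a \<in> B. i \<in> S2 a}"
          by (auto simp: S1_def S2_def)
        then have "r i {a \<in> A \<inter> B - {e}. i \<in> S a} \<le> r i ({a \<in> A. i \<in> S1 a} \<inter> {a \<in> B. i \<in> S2 a})"
          using mono i by blast
        then show "r i {a \<in> A \<union> B. i \<in> S a} + r i {a \<in> A \<inter> B - {e}. i \<in> S a}
            \<le> r i {a \<in> A. i \<in> S1 a} + r i {a \<in> B. i \<in> S2 a}"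
          unfolding un using submod[OF i, of "{a \<in> A. i \<in> S1 a}" "{a \<in> B. i \<in> S2 a}"] by linarith
      qed
      also have "\<dots> + 2 \<le> card A + card B"
        using A B by (simp add: sum.distrib)
      also have "\<dots> = card (A \<union> B) + card (A \<inter> B)"
        by (rule card_Un_Int) auto
      also have "card (A \<inter> B) = Suc (card (A \<inter> B - {e}))"
        using \<open>e \<in> A\<close> \<open>e \<in> B\<close> by (intro card.remove) auto
      finally show False by simp
    qed
  qed
qed

section \<open>Spaces of functions\<close>

definition fscale :: "'a::field \<Rightarrow> ('b \<Rightarrow> 'a) \<Rightarrow> 'b \<Rightarrow> 'a" where
  "fscale c f = (\<lambda>x. c * f x)"

lemma fscale_apply: "fscale c f x = c * f x"
  by (simp add: fscale_def)

interpretation fs: vector_space fscale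
  by standard (auto simp: fun_eq_iff fscale_apply algebra_simps)

lemma fscale_times: "fscale c f * g = fscale c (f * g)" "f * fscale c g = fscale c (f * g)"
  by (auto simp: fscale_apply fun_eq_iff)

lemma sum_fun_apply: "(\<Sum>i\<in>A. f i) x = (\<Sum>i\<in>A. f i x)" for f :: "'i \<Rightarrow> 'b \<Rightarrow> 'a::comm_monoid_add"
  by (induction A rule: infinite_finite_induct) auto

text \<open>The pointwise product is bilinear, so it is enough to multiply generators.\<close>

lemma span_times:
  assumes "f \<in> fs.span S" "g \<in> fs.span T"
    and "\<And>f g. f \<in> S \<Longrightarrow> g \<in> T \<Longrightarrow> f * g \<in> fs.span U"
  shows "f * g \<in> fs.span U"
  using assms(1)
proof (induction rule: fs.span_induct_alt)
  case base
  show ?case by (metis mult_zero_left fs.span_zero)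
next
  case (step c f h)
  have "f * g \<in> fs.span U"
    using assms(2)
  proof (induction rule: fs.span_induct_alt)
    case base
    show ?case by (metis mult_zero_right fs.span_zero)
  next
    case (step c g h)
    then show ?case
      using assms(3) \<open>f \<in> S\<close> unfolding distrib_left fscale_times
      by (blast intro: fs.span_add fs.span_scale)
  qed
  then show ?case
    using step unfolding distrib_right fscale_times
    by (blast intro: fs.span_add fs.span_scale)
qed

lemma finite_basis_exists:
  assumes "finite T"
  obtains B where "finite B" "B \<subseteq> T" "fs.span B = fs.span T" "card B = fs.dim T"
proof -
  obtain B where "B \<subseteq> T" "fs.independent B" "T \<subseteq> fs.span B" "card B = fs.dim T"
    by (rule fs.basis_exists)
  then show thesis
    using that assms finite_subset fs.span_eq[of B T] fs.span_superset[of T] by blast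
qed

lemma fdim_mono:
  assumes "finite T" "S \<subseteq> fs.span T"
  shows "fs.dim S \<le> fs.dim T"
proof -
  obtain B where "finite B" "fs.span B = fs.span T" "card B = fs.dim T"
    using finite_basis_exists[OF assms(1)] .
  then show ?thesis
    using fs.dim_le_card[of S B] assms(2) by simp
qed

text \<open>An injective linear map sends a basis of \<open>G\<close> to independent vectors in the
  span of \<open>T\<close>. It serves twice: for the pullback along addition, and for multiplication
  by a power of a leading coefficient.\<close>

lemma fdim_le_card_image:
  fixes \<Phi> :: "('b \<Rightarrow> 'a::field) \<Rightarrow> 'c \<Rightarrow> 'a"
  assumes add: "\<And>f g. \<Phi> (f + g) = \<Phi> f + \<Phi> g"
    and scale: "\<And>c f. \<Phi> (fscale c f) = fscale c (\<Phi> f)"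
    and inj: "\<And>f. f \<in> fs.span G \<Longrightarrow> \<Phi> f = 0 \<Longrightarrow> f = 0"
    and T: "finite T" "\<And>g. g \<in> G \<Longrightarrow> \<Phi> g \<in> fs.span T"
  shows "fs.dim G \<le> card T"
proof -
  interpret module_hom fscale fscale \<Phi>
    by unfold_locales (simp_all add: add scale)
  obtain B where B: "B \<subseteq> G" "fs.independent B" "card B = fs.dim G"
    by (meson fs.basis_exists)
  have inj_on: "inj_on \<Phi> (fs.span G)"
    by (rule inj_onI) (metis diff eq_iff_diff_eq_0 fs.span_diff inj)
  then have "inj_on \<Phi> (fs.span B)"
    by (rule inj_on_subset) (rule fs.span_mono[OF B(1)])
  then have "fs.independent (\<Phi> ` B)"
    using B independent_injective_image by blast
  moreover have "\<Phi> ` B \<subseteq> fs.span T"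
    using B T by blast
  ultimately have "card (\<Phi> ` B) \<le> card T"
    using fs.independent_span_bound T by blast
  moreover have "card (\<Phi> ` B) = card B"
    using inj_on B fs.span_superset by (metis card_image inj_on_subset)
  ultimately show ?thesis using B by simp
qed

section \<open>Dimensions of spaces of restricted polynomials\<close>

definition monom_eval :: "('n::finite \<Rightarrow> nat) \<Rightarrow> 'a::field ^ 'n \<Rightarrow> 'a" where
  "monom_eval p x = (\<Prod>i\<in>UNIV. (x $ i) ^ p i)"

text \<open>Restriction to \<open>X\<close> is encoded by extending with \<open>0\<close> outside \<open>X\<close>.\<close>

definition rmonom :: "('a::field ^ 'n::finite) set \<Rightarrow> ('n \<Rightarrow> nat) \<Rightarrow> 'a ^ 'n \<Rightarrow> 'a" where
  "rmonom X p = (\<lambda>x. if x \<in> X then monom_eval p x else 0)"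

definition restricted_polys :: "('a::field ^ 'n::finite) set \<Rightarrow> ('n \<Rightarrow> nat) \<Rightarrow> ('a ^ 'n \<Rightarrow> 'a) set" where
  "restricted_polys X b = fs.span (rmonom X ` {..b})"

text \<open>An affine Hilbert function with a separate degree bound for each variable; at
  \<open>b = cube A d\<close> it is the dimension \<open>H(X, A, d)\<close>.\<close>

definition hilb :: "('a::field ^ 'n::finite) set \<Rightarrow> ('n \<Rightarrow> nat) \<Rightarrow> nat" where
  "hilb X b = fs.dim (rmonom X ` {..b})"

definition cube :: "'n set \<Rightarrow> nat \<Rightarrow> 'n \<Rightarrow> nat" where
  "cube A d = (\<lambda>i. if i \<in> A then d else 0)"

text \<open>Relations are finite coefficient families indexed by exponent functions, which fits
  linear algebra in function spaces; \<open>alg_indep_iff\<close> links this to the vanishing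
  ideal.\<close>

definition alg_indep :: "('a::field ^ 'n::finite) set \<Rightarrow> 'n set \<Rightarrow> bool" where
  "alg_indep X E \<longleftrightarrow>
     (\<forall>F a. finite F \<longrightarrow> (\<forall>p\<in>F. \<forall>i. i \<notin> E \<longrightarrow> p i = 0) \<longrightarrow>
       (\<forall>x\<in>X. (\<Sum>p\<in>F. a p * monom_eval p x) = 0) \<longrightarrow> (\<forall>p\<in>F. a p = 0))"

text \<open>For nonempty \<open>X\<close> this is primality of the vanishing ideal, phrased as
  absence of zero divisors among restricted polynomials.\<close>

definition prime_on :: "('a::field ^ 'n::finite) set \<Rightarrow> bool" where
  "prime_on X \<longleftrightarrow> (\<forall>b b' f g. f \<in> restricted_polys X b \<longrightarrow> g \<in> restricted_polys X b' \<longrightarrow>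
     f * g = 0 \<longrightarrow> f = 0 \<or> g = 0)"

lemma exponents_atMost: "{..b} = Pi\<^sub>E UNIV (\<lambda>i. {..b i})" for b :: "'n::finite \<Rightarrow> nat"
  by (auto simp: le_fun_def PiE_def Pi_def)

lemma finite_exponents [simp]: "finite {..b}" for b :: "'n::finite \<Rightarrow> nat"
  unfolding exponents_atMost by (rule finite_PiE) auto

lemma card_cube: "card {..cube A d} = (d + 1) ^ card A" for A :: "'n::finite set"
proof -
  have "card {..cube A d} = (\<Prod>i\<in>UNIV. if i \<in> A then d + 1 else 1)"
    unfolding exponents_atMost by (subst card_PiE) (auto simp: cube_def intro: prod.cong)
  also have "\<dots> = (d + 1) ^ card A"
    by (simp add: prod.If_cases)
  finally show ?thesis .
qed

lemma cube_mono: "A \<subseteq> B \<Longrightarrow> cube A d \<le> cube B d"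
  by (auto simp: cube_def le_fun_def)

lemma monom_eval_add: "monom_eval (p + q) x = monom_eval p x * monom_eval q x"
  by (simp add: monom_eval_def power_add prod.distrib)

lemma rmonom_times: "rmonom X p * rmonom X q = rmonom X (p + q)"
  by (auto simp: rmonom_def fun_eq_iff monom_eval_add)

lemma rmonom_mem: "p \<le> b \<Longrightarrow> rmonom X p \<in> restricted_polys X b"
  unfolding restricted_polys_def by (rule fs.span_base) auto

lemma restricted_polys_outside:
  assumes "f \<in> restricted_polys X b" "z \<notin> X"
  shows "f z = 0"
  using assms(1) unfolding restricted_polys_def
proof (induction rule: fs.span_induct_alt)
  case (step c f g)
  then have "f z = 0"
    using assms(2) by (auto simp: rmonom_def)
  then show ?case
    using step by (simp add: fscale_apply)
qed simp

lemma restricted_polys_times: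
  assumes "f \<in> restricted_polys X b" "g \<in> restricted_polys X b'"
  shows "f * g \<in> restricted_polys X (b + b')"
  using assms unfolding restricted_polys_def
proof (rule span_times)
  fix f g assume "f \<in> rmonom X ` {..b}" "g \<in> rmonom X ` {..b'}"
  then show "f * g \<in> fs.span (rmonom X ` {..b + b'})"
    by (auto simp: rmonom_times le_fun_def intro!: fs.span_base imageI add_mono)
qed

lemma hilb_mono:
  assumes "b \<le> b'"
  shows "hilb X b \<le> hilb X b'"
  unfolding hilb_def
proof (rule fdim_mono)
  show "rmonom X ` {..b} \<subseteq> fs.span (rmonom X ` {..b'})"
    by (rule order_trans[OF image_mono fs.span_superset]) (use assms in auto)
qed simp

lemma hilb_le: "hilb X b \<le> card {..b}"
  unfolding hilb_def by (rule order_trans[OF fs.dim_le_card' card_image_le]) auto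

lemma restricted_polys_basis:
  obtains B where "finite B" "fs.span B = restricted_polys X b" "card B = hilb X b"
  unfolding hilb_def restricted_polys_def
  using finite_basis_exists[OF finite_imageI[OF finite_exponents]] .

lemma alg_indepD:
  assumes "alg_indep X E" "finite F" "\<And>p i. p \<in> F \<Longrightarrow> i \<notin> E \<Longrightarrow> p i = 0"
    and "\<And>x. x \<in> X \<Longrightarrow> (\<Sum>p\<in>F. a p * monom_eval p x) = 0" "p \<in> F"
  shows "a p = 0"
  using assms unfolding alg_indep_def by blast

lemma alg_indep_subset:
  assumes "alg_indep X E" "E' \<subseteq> E"
  shows "alg_indep X E'"
  unfolding alg_indep_def
proof (intro allI impI)
  fix F a
  assume "finite F" "\<forall>p\<in>F. \<forall>i. i \<notin> E' \<longrightarrow> p i = 0"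
    "\<forall>x\<in>X. (\<Sum>p\<in>F. a p * monom_eval p x) = 0"
  moreover from this have "\<forall>p\<in>F. \<forall>i. i \<notin> E \<longrightarrow> p i = 0"
    using assms(2) by blast
  ultimately show "\<forall>p\<in>F. a p = 0"
    using assms(1) unfolding alg_indep_def by meson
qed

text \<open>A relation without variables is a single constant, and evaluation at a point of
  \<open>X\<close> shows that it is zero.\<close>

lemma alg_indep_empty: "X \<noteq> {} \<Longrightarrow> alg_indep X {}"
  unfolding alg_indep_def
proof (intro allI impI ballI)
  fix F and a :: "('b \<Rightarrow> nat) \<Rightarrow> 'a" and p
  assume "X \<noteq> {}" and F: "\<forall>p\<in>F. \<forall>i. i \<notin> {} \<longrightarrow> p i = 0"
    and sum: "\<forall>x\<in>X. (\<Sum>p\<in>F. a p * monom_eval p x) = 0" and p: "p \<in> F"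
  have "q = p" if "q \<in> F" for q
    using F that p by (metis emptyE ext)
  then have "F = {p}"
    using p by blast
  moreover have "p i = 0" for i
    using F p by simp
  then have "monom_eval p x = 1" for x :: "'a ^ 'b"
    by (simp add: monom_eval_def)
  ultimately have "a p = (\<Sum>q\<in>F. a q * monom_eval q x)" for x :: "'a ^ 'b"
    by simp
  then show "a p = 0"
    using sum \<open>X \<noteq> {}\<close> by (metis all_not_in_conv)
qed

text \<open>A linear relation among restricted monomials in the variables \<open>A\<close> is an
  algebraic relation on \<open>X\<close>. So the monomials of the box stay distinct and linearly
  independent, and counting them gives the dimension.\<close>

lemma hilb_alg_indep:
  assumes "alg_indep X A"
  shows "hilb X (cube A d) = (d + 1) ^ card A"
proof -
  let ?P = "{..cube A d}"
  have supp: "p i = 0" if "p \<in> ?P" "i \<notin> A" for p i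
    using that by (auto simp: cube_def le_fun_def dest: spec[of _ i])
  have inj: "inj_on (rmonom X) ?P"
  proof (rule inj_onI, rule ccontr)
    fix p q assume pq: "p \<in> ?P" "q \<in> ?P" "rmonom X p = rmonom X q" "p \<noteq> q"
    have "monom_eval p x = monom_eval q x" if "x \<in> X" for x
      using fun_cong[OF pq(3), of x] that by (simp add: rmonom_def)
    then have "(if p = p then 1 else -1 :: 'a) = 0"
      using pq supp
      by (intro alg_indepD[OF assms, of "{p, q}" "\<lambda>r. if r = p then 1 else -1"]) auto
    then show False by simp
  qed
  have "fs.independent (rmonom X ` ?P)"
    unfolding fs.independent_explicit_finite_subsets
  proof (intro allI impI ballI)
    fix S u v
    assume S: "S \<subseteq> rmonom X ` ?P" "finite S" "(\<Sum>v\<in>S. fscale (u v) v) = 0" "v \<in> S"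
    then obtain F where F: "F \<subseteq> ?P" "S = rmonom X ` F"
      by (auto simp: subset_image_iff)
    have "finite F"
      using F finite_subset finite_exponents by blast
    have injF: "inj_on (rmonom X) F"
      using inj F inj_on_subset by blast
    have "(\<Sum>p\<in>F. u (rmonom X p) * monom_eval p x) = 0" if "x \<in> X" for x
    proof -
      have "(\<Sum>p\<in>F. u (rmonom X p) * monom_eval p x) = (\<Sum>p\<in>F. fscale (u (rmonom X p)) (rmonom X p)) x"
        using that by (simp add: sum_fun_apply fscale_apply rmonom_def)
      also have "\<dots> = (\<Sum>v\<in>S. fscale (u v) v) x"
        unfolding F(2) by (subst sum.reindex[OF injF]) simp
      finally show ?thesis using S by simp
    qed
    then have "u (rmonom X p) = 0" if "p \<in> F" for p
      using that F supp \<open>finite F\<close>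
      by (intro alg_indepD[OF assms, of F "\<lambda>p. u (rmonom X p)"]) auto
    then show "u v = 0"
      using S F by auto
  qed
  then have "hilb X (cube A d) = card (rmonom X ` ?P)"
    unfolding hilb_def by (rule fs.dim_eq_card_independent)
  then show ?thesis
    by (simp add: card_image[OF inj] card_cube)
qed

section \<open>Submultiplicativity under sums of sets\<close>

lemma monom_eval_plus:
  "monom_eval p (x + y) =
     (\<Sum>q\<le>p. (\<Prod>i\<in>UNIV. of_nat (p i choose q i)) * (monom_eval q x * monom_eval (\<lambda>i. p i - q i) y))"
proof -
  have "monom_eval p (x + y) =
      (\<Prod>i\<in>UNIV. \<Sum>k\<le>p i. of_nat (p i choose k) * (x $ i) ^ k * (y $ i) ^ (p i - k))"
    by (simp add: monom_eval_def binomial_ring)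
  also have "\<dots> = (\<Sum>q\<in>Pi\<^sub>E UNIV (\<lambda>i. {..p i}).
      \<Prod>i\<in>UNIV. of_nat (p i choose q i) * (x $ i) ^ q i * (y $ i) ^ (p i - q i))"
    by (rule prod_sum_PiE) auto
  also have "\<dots> = (\<Sum>q\<le>p. \<Prod>i\<in>UNIV. of_nat (p i choose q i) * (x $ i) ^ q i * (y $ i) ^ (p i - q i))"
    by (simp only: exponents_atMost)
  finally show ?thesis
    by (simp add: prod.distrib monom_eval_def mult.assoc)
qed

text \<open>Pull functions back along addition from \<open>X \<times> Y\<close> onto the set of
  sums; this is injective. By the binomial expansion a pulled-back monomial is a combination of
  products of monomials bounded by \<open>b\<close>, hence lies in the span of products of basis
  elements of the two factors.\<close>

lemma hilb_sumset:
  fixes X Y :: "('a::field ^ 'n::finite) set"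
  shows "hilb {x + y | x y. x \<in> X \<and> y \<in> Y} b \<le> hilb X b * hilb Y b"
proof -
  let ?S = "{x + y | x y. x \<in> X \<and> y \<in> Y}"
  obtain B where B: "finite B" "fs.span B = restricted_polys X b" "card B = hilb X b"
    by (rule restricted_polys_basis)
  obtain C where C: "finite C" "fs.span C = restricted_polys Y b" "card C = hilb Y b"
    by (rule restricted_polys_basis)
  define \<Phi> :: "('a ^ 'n \<Rightarrow> 'a) \<Rightarrow> ('a ^ 'n) \<times> ('a ^ 'n) \<Rightarrow> 'a"
    where "\<Phi> f = (\<lambda>(x, y). if x \<in> X \<and> y \<in> Y then f (x + y) else 0)" for f
  define tens :: "('a ^ 'n \<Rightarrow> 'a) \<Rightarrow> ('a ^ 'n \<Rightarrow> 'a) \<Rightarrow> ('a ^ 'n) \<times> ('a ^ 'n) \<Rightarrow> 'a"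
    where "tens f g = (\<lambda>(x, y). f x * g y)" for f g
  define T where "T = (\<lambda>(f, g). tens f g) ` (B \<times> C)"
  have tens_mem: "tens f g \<in> fs.span T" if "f \<in> fs.span B" "g \<in> fs.span C" for f g
    using that(1)
  proof (induction rule: fs.span_induct_alt)
    case base
    have "tens 0 g = 0" by (auto simp: tens_def fun_eq_iff)
    then show ?case by (metis fs.span_zero)
  next
    case (step c f h)
    have "tens f g \<in> fs.span T"
      using that(2)
    proof (induction rule: fs.span_induct_alt)
      case base
      have "tens f 0 = 0" by (auto simp: tens_def fun_eq_iff)
      then show ?case by (metis fs.span_zero)
    next
      case (step c g h)
      have "tens f (fscale c g + h) = fscale c (tens f g) + tens f h"
        by (auto simp: tens_def fun_eq_iff fscale_apply algebra_simps)
      moreover have "tens f g \<in> fs.span T"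
        using step(1) \<open>f \<in> B\<close> by (auto simp: T_def intro!: fs.span_base)
      ultimately show ?case
        using step by (metis fs.span_add fs.span_scale)
    qed
    moreover have "tens (fscale c f + h) g = fscale c (tens f g) + tens h g"
      by (auto simp: tens_def fun_eq_iff fscale_apply algebra_simps)
    ultimately show ?case
      using step by (metis fs.span_add fs.span_scale)
  qed
  have "hilb ?S b \<le> card T"
    unfolding hilb_def
  proof (rule fdim_le_card_image[where \<Phi> = \<Phi>])
    show "\<Phi> (f + g) = \<Phi> f + \<Phi> g" for f g
      by (auto simp: \<Phi>_def fscale_apply fun_eq_iff)
    show "\<Phi> (fscale c f) = fscale c (\<Phi> f)" for c f
      by (auto simp: \<Phi>_def fscale_apply fun_eq_iff)
    show "finite T"
      using B C by (simp add: T_def)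
  next
    fix f assume f: "f \<in> fs.span (rmonom ?S ` {..b})" "\<Phi> f = 0"
    have off: "f z = 0" if "z \<notin> ?S" for z
      by (rule restricted_polys_outside[OF _ that, of f b]) (use f in \<open>simp add: restricted_polys_def\<close>)
    have on: "f (x + y) = 0" if "x \<in> X" "y \<in> Y" for x y
      using fun_cong[OF f(2), of "(x, y)"] that by (simp add: \<Phi>_def)
    have "f z = 0" for z
      using off[of z] on by (cases "z \<in> ?S") auto
    then show "f = 0"
      by (simp add: fun_eq_iff)
  next
    fix g assume "g \<in> rmonom ?S ` {..b}"
    then obtain p where p: "p \<le> b" "g = rmonom ?S p"
      by auto
    have "\<Phi> g = (\<Sum>q\<le>p. fscale (\<Prod>i\<in>UNIV. of_nat (p i choose q i))
        (tens (rmonom X q) (rmonom Y (\<lambda>i. p i - q i))))" (is "_ = ?R")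
    proof
      fix z :: "('a ^ 'n) \<times> ('a ^ 'n)"
      obtain x y where z: "z = (x, y)" by (cases z)
      show "\<Phi> g z = ?R z"
      proof (cases "x \<in> X \<and> y \<in> Y")
        case True
        then have "\<Phi> g z = monom_eval p (x + y)"
          by (auto simp: \<Phi>_def p rmonom_def z)
        then show ?thesis
          using True by (simp add: z monom_eval_plus sum_fun_apply fscale_apply tens_def rmonom_def)
      next
        case False
        then show ?thesis
          by (auto simp: z \<Phi>_def sum_fun_apply fscale_apply tens_def rmonom_def)
      qed
    qed
    also have "\<dots> \<in> fs.span T"
    proof (intro fs.span_sum fs.span_scale tens_mem)
      fix q assume "q \<in> {..p}"
      then show "rmonom X q \<in> fs.span B"
        using p order_trans by (auto simp: B intro!: rmonom_mem)
      have "(\<lambda>i. p i - q i) \<le> b"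
        using p by (auto simp: le_fun_def intro: le_trans diff_le_self)
      then show "rmonom Y (\<lambda>i. p i - q i) \<in> fs.span C"
        by (auto simp: C intro!: rmonom_mem)
    qed
    finally show "\<Phi> g \<in> fs.span T" .
  qed
  also have "\<dots> \<le> card (B \<times> C)"
    unfolding T_def using B C by (intro card_image_le) auto
  finally show ?thesis
    using B C by (simp add: card_cartesian_product)
qed

section \<open>Growth and algebraic dependence\<close>

text \<open>Terms with zero coefficient are discarded, so that the degree of the relation in a
  variable can be read off from \<open>F\<close>.\<close>

lemma not_alg_indepE:
  assumes "\<not> alg_indep X E"
  obtains F a where "finite F" "F \<noteq> {}" "\<And>p. p \<in> F \<Longrightarrow> a p \<noteq> 0"
    "\<And>p i. p \<in> F \<Longrightarrow> i \<notin> E \<Longrightarrow> p i = 0"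
    "\<And>x. x \<in> X \<Longrightarrow> (\<Sum>p\<in>F. a p * monom_eval p x) = 0"
proof -
  obtain F a where F: "finite F" "\<forall>p\<in>F. \<forall>i. i \<notin> E \<longrightarrow> p i = 0"
    "\<forall>x\<in>X. (\<Sum>p\<in>F. a p * monom_eval p x) = 0" and "\<not> (\<forall>p\<in>F. a p = 0)"
    using assms unfolding alg_indep_def not_all not_imp by (elim exE conjE) (rule that)
  then obtain q where q: "q \<in> F" "a q \<noteq> 0"
    by blast
  let ?F = "{p \<in> F. a p \<noteq> 0}"
  have sum: "(\<Sum>p\<in>?F. a p * monom_eval p x) = 0" if "x \<in> X" for x
  proof -
    have "(\<Sum>p\<in>?F. a p * monom_eval p x) = (\<Sum>p\<in>F. a p * monom_eval p x)"
      by (rule sum.mono_neutral_left) (use F(1) in auto)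
    then show ?thesis
      using F(3) that by simp
  qed
  show thesis
    using q F(2) by (intro that[of ?F a] sum) (simp_all add: F(1), blast)
qed

text \<open>If \<open>e\<close> is algebraic over \<open>I \<subseteq> A\<close>, a relation of degree \<open>D\<close> in \<open>e\<close> with leading coefficient
  \<open>q\<close> rewrites \<open>q\<close> times the \<open>D\<close>-th power of \<open>e\<close> through lower powers. So multiplication by \<open>q ^ d\<close>, which is
  injective because the ideal of \<open>X\<close> is prime, pushes polynomials of degree \<open>d\<close> in \<open>e\<close> down to
  degree below \<open>D\<close>, at the cost of a linear growth of the degrees in \<open>A\<close>.\<close>

lemma hilb_insert_algebraic:
  fixes X :: "('a::field ^ 'n::finite) set"
  assumes prime: "prime_on X" and indep: "alg_indep X I" and "I \<subseteq> A" "e \<notin> A"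
    and dep: "\<not> alg_indep X (insert e I)"
  shows "\<exists>D K. \<forall>d. hilb X (cube (insert e A) d) \<le> D * hilb X (cube A (d + d * K))"
proof -
  obtain F a where F: "finite F" "F \<noteq> {}" and a: "\<And>p. p \<in> F \<Longrightarrow> a p \<noteq> (0::'a)"
    and supp: "\<And>p i. p \<in> F \<Longrightarrow> i \<notin> insert e I \<Longrightarrow> p i = 0"
    and rel: "\<And>x. x \<in> X \<Longrightarrow> (\<Sum>p\<in>F. a p * monom_eval p x) = 0"
    by (rule not_alg_indepE[OF dep]) blast
  have "e \<notin> I"
    using assms by blast
  \<comment> \<open>\<open>D\<close> is the degree of the relation in \<open>e\<close>,
    \<open>c j\<close> the coefficient of the \<open>j\<close>-th power of \<open>e\<close>, and
    \<open>K\<close> a crude bound for all exponents, hence for the degrees of each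
    \<open>c j\<close>.\<close>
  define D where "D = Max ((\<lambda>p. p e) ` F)"
  define K where "K = (\<Sum>p\<in>F. \<Sum>i\<in>UNIV. p i)"
  define E where "E j = (\<lambda>i. if i = e then j else 0 :: nat)" for j
  define c where "c j = (\<Sum>p | p \<in> F \<and> p e = j. fscale (a p) (rmonom X (p(e := 0))))" for j
  define q where "q = c D"
  have le_D: "p e \<le> D" if "p \<in> F" for p
    using F that by (auto simp: D_def)
  have D_attained: "\<exists>p\<in>F. p e = D"
  proof -
    have "D \<in> (\<lambda>p. p e) ` F"
      unfolding D_def by (rule Max_in) (use F in auto)
    then show ?thesis by auto
  qed
  have split: "E (p e) + p(e := 0) = p" for p
    by (auto simp: E_def)
  have le_K: "p i \<le> K" if "p \<in> F" for p i
  proof -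
    have "p i \<le> (\<Sum>i\<in>UNIV. p i)"
      by (rule member_le_sum) auto
    also have "\<dots> \<le> K"
      unfolding K_def by (rule member_le_sum) (use F that in auto)
    finally show ?thesis .
  qed
  have c_mem: "c j \<in> restricted_polys X (cube A K)" for j
  proof -
    have mem: "rmonom X (p(e := 0)) \<in> fs.span (rmonom X ` {..cube A K})" if "p \<in> F" for p
    proof -
      have "(p(e := 0)) i \<le> cube A K i" for i
        using le_K[OF that, of i] supp[OF that, of i] \<open>I \<subseteq> A\<close> by (auto simp: cube_def)
      then have "p(e := 0) \<le> cube A K"
        by (rule le_funI)
      then show ?thesis
        by (rule rmonom_mem[unfolded restricted_polys_def])
    qed
    show ?thesis
      unfolding c_def restricted_polys_def
      by (intro fs.span_sum fs.span_scale mem) simp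
  qed
  have c_apply: "c j x = (\<Sum>p | p \<in> F \<and> p e = j. a p * monom_eval (p(e := 0)) x)" if "x \<in> X" for j x
    using that by (simp add: c_def sum_fun_apply fscale_apply rmonom_def)
  have rel_c: "(\<Sum>j\<le>D. c j * rmonom X (E j)) = 0"
  proof
    fix x
    show "(\<Sum>j\<le>D. c j * rmonom X (E j)) x = 0 x"
    proof (cases "x \<in> X")
      case True
      have "(\<Sum>j\<le>D. c j * rmonom X (E j)) x
          = (\<Sum>j\<le>D. \<Sum>p | p \<in> F \<and> p e = j. a p * monom_eval (p(e := 0)) x * monom_eval (E j) x)"
        using True by (simp add: sum_fun_apply c_apply sum_distrib_right rmonom_def)
      also have "\<dots> = (\<Sum>j\<le>D. \<Sum>p | p \<in> F \<and> p e = j. a p * monom_eval p x)"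
      proof (intro sum.cong refl)
        fix j p assume "p \<in> {p \<in> F. p e = j}"
        then have "monom_eval p x = monom_eval (E j) x * monom_eval (p(e := 0)) x"
          using monom_eval_add[of "E j" "p(e := 0)" x] split[of p] by simp
        then show "a p * monom_eval (p(e := 0)) x * monom_eval (E j) x = a p * monom_eval p x"
          by simp
      qed
      also have "\<dots> = (\<Sum>p\<in>F. a p * monom_eval p x)"
        by (rule sum.group) (use F le_D in auto)
      finally show ?thesis
        using rel True by simp
    next
      case False
      then show ?thesis
        by (simp add: sum_fun_apply rmonom_def)
    qed
  qed
  \<comment> \<open>\<open>q\<close> involves only the variables \<open>I\<close> and has nonzero
    coefficients, so its vanishing on \<open>X\<close> would contradict the independence of
    \<open>I\<close>.\<close>
  have q_ne: "q \<noteq> 0"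
  proof
    assume "q = 0"
    let ?F = "{p \<in> F. p e = D}"
    have inj: "inj_on (\<lambda>p. p(e := 0)) ?F"
      by (rule inj_onI) (metis (mono_tags) fun_upd_triv fun_upd_upd mem_Collect_eq)
    obtain p where p: "p \<in> F" "p e = D"
      using D_attained by blast
    have "a ((p(e := 0))(e := D)) = 0"
    proof (rule alg_indepD[OF indep, of "(\<lambda>p. p(e := 0)) ` ?F" "\<lambda>p. a (p(e := D))"])
      show "(\<Sum>p\<in>(\<lambda>p. p(e := 0)) ` ?F. a (p(e := D)) * monom_eval p x) = 0" if "x \<in> X" for x
      proof -
        have "(\<Sum>p\<in>(\<lambda>p. p(e := 0)) ` ?F. a (p(e := D)) * monom_eval p x)
            = (\<Sum>p\<in>?F. a p * monom_eval (p(e := 0)) x)"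
          unfolding sum.reindex[OF inj] by (rule sum.cong) auto
        also have "\<dots> = q x"
          using c_apply that by (simp add: q_def)
        finally show ?thesis
          using \<open>q = 0\<close> by simp
      qed
      show "p i = 0" if "p \<in> (\<lambda>p. p(e := 0)) ` ?F" "i \<notin> I" for p i
        using that supp by auto
    qed (use F p in auto)
    moreover have "(p(e := 0))(e := D) = p"
      using p by auto
    ultimately show False
      using a p by simp
  qed
  \<comment> \<open>For \<open>D = 0\<close> the relation would say \<open>q = 0\<close>. The degree
    bound \<open>D - 1\<close> below relies on this.\<close>
  have "D \<noteq> 0"
  proof
    assume "D = 0"
    have "c 0 x = 0" for x
    proof (cases "x \<in> X")
      case True
      have "c 0 * rmonom X (E 0) = 0"
        using rel_c unfolding \<open>D = 0\<close> by simp
      then have "c 0 x * rmonom X (E 0) x = 0"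
        by (simp only: times_fun_def fun_eq_iff zero_fun_apply)
      moreover have "rmonom X (E 0) x = 1"
        using True by (simp add: rmonom_def monom_eval_def E_def)
      ultimately show ?thesis
        by simp
    next
      case False
      then show ?thesis
        using restricted_polys_outside c_mem by blast
    qed
    then show False
      using q_ne \<open>D = 0\<close> by (simp add: q_def fun_eq_iff)
  qed
  have lead: "q * rmonom X (E D) = - (\<Sum>j<D. c j * rmonom X (E j))"
  proof -
    have "(\<Sum>j<D. c j * rmonom X (E j)) + q * rmonom X (E D) = 0"
      using rel_c by (simp only: lessThan_Suc_atMost[symmetric] sum.lessThan_Suc q_def)
    then show ?thesis
      by (simp only: add_eq_0_iff)
  qed
  \<comment> \<open>Degree below \<open>D\<close> in \<open>e\<close> and at most
    \<open>d + n * K\<close> in the variables of \<open>A\<close>: multiplication by any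
    \<open>c j\<close> raises \<open>n\<close> by one.\<close>
  define W where "W d n = restricted_polys X ((cube A (d + n * K))(e := D - 1))" for d n
  have cube_e: "cube A d e = 0" for d
    using \<open>e \<notin> A\<close> by (simp add: cube_def)
  have cube_add: "cube A K + (cube A (d + n * K))(e := D - 1) = (cube A (d + Suc n * K))(e := D - 1)" for d n
    using \<open>e \<notin> A\<close> by (intro ext) (simp add: cube_def)
  have mult_c: "c j * f \<in> W d (Suc n)" if "f \<in> W d n" for j f d n
    using restricted_polys_times[OF c_mem that[unfolded W_def]] unfolding W_def cube_add .
  \<comment> \<open>Multiplying by \<open>e\<close> either keeps the degree in \<open>e\<close>
    below \<open>D\<close>, or reaches exactly \<open>D\<close>, where \<open>lead\<close> rewrites
    the product with \<open>q\<close> through lower powers.\<close>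
  have mult_qe: "q * rmonom X (E 1) * f \<in> W d (Suc n)" if "f \<in> W d n" for f d n
  proof -
    have "q * rmonom X (E 1) \<in> fs.span {q * rmonom X (E 1)}"
      by (rule fs.span_base) simp
    then show ?thesis
      using that unfolding W_def restricted_polys_def
    proof (rule span_times, unfold restricted_polys_def[symmetric] W_def[symmetric])
      fix g h assume "g \<in> {q * rmonom X (E 1)}" "h \<in> rmonom X ` {..(cube A (d + n * K))(e := D - 1)}"
      then obtain r where r: "r \<le> (cube A (d + n * K))(e := D - 1)"
        and "g = q * rmonom X (E 1)" "h = rmonom X r"
        by blast
      then have gh: "g * h = q * rmonom X (E 1 + r)"
        by (simp only: mult.assoc rmonom_times)
      have r_e: "r e \<le> D - 1" and r_le: "\<And>i. i \<noteq> e \<Longrightarrow> r i \<le> cube A (d + n * K) i"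
        using r unfolding le_fun_def by (metis fun_upd_same, metis fun_upd_other)
      show "g * h \<in> W d (Suc n)"
      proof (cases "r e < D - 1")
        case True
        then have "E 1 + r \<le> (cube A (d + n * K))(e := D - 1)"
          using r_le by (auto simp: le_fun_def E_def split: if_splits)
        then have "rmonom X (E 1 + r) \<in> W d n"
          unfolding W_def by (rule rmonom_mem)
        then show ?thesis
          unfolding gh q_def by (rule mult_c)
      next
        case False
        then have "r e = D - 1"
          using r_e by simp
        then have "E 1 + r = E D + r(e := 0)"
          using \<open>D \<noteq> 0\<close> by (auto simp: E_def fun_eq_iff)
        then have "g * h = q * rmonom X (E D) * rmonom X (r(e := 0))"
          by (simp only: gh mult.assoc rmonom_times)
        also have "\<dots> = - (\<Sum>j<D. c j * rmonom X (E j + r(e := 0)))"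
          by (simp only: lead mult_minus_left sum_distrib_right mult.assoc rmonom_times)
        also have "\<dots> \<in> W d (Suc n)"
        proof -
          have "rmonom X (E j + r(e := 0)) \<in> W d n" if "j < D" for j
            unfolding W_def
            by (rule rmonom_mem) (use that r_e r_le in \<open>auto simp: le_fun_def E_def split: if_splits\<close>)
          then have "c j * rmonom X (E j + r(e := 0)) \<in> W d (Suc n)" if "j < D" for j
            using mult_c that by blast
          then show ?thesis
            unfolding W_def restricted_polys_def by (intro fs.span_neg fs.span_sum) auto
        qed
        finally show ?thesis .
      qed
    qed
  qed
  \<comment> \<open>Each power of \<open>e\<close> is absorbed by one factor \<open>q\<close>;
    surplus factors \<open>q\<close> only raise the degrees in \<open>A\<close>.\<close>
  have power_mem: "q ^ n * rmonom X (E j + r) \<in> W d n" if "j \<le> n" "r \<le> cube A d" for n j r d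
    using that(1)
  proof (induction n arbitrary: j)
    case 0
    have "E 0 + r = r"
      by (auto simp: E_def)
    moreover have "r i \<le> ((cube A (d + 0 * K))(e := D - 1)) i" for i
      using le_funD[OF that(2), of i] cube_e[of d] by auto
    then have "r \<le> (cube A (d + 0 * K))(e := D - 1)"
      by (rule le_funI)
    ultimately show ?case
      using 0 unfolding W_def by (simp add: rmonom_mem)
  next
    case (Suc n)
    show ?case
    proof (cases "j \<le> n")
      case True
      then show ?thesis
        using mult_c[OF Suc.IH[OF True], of D] by (simp only: q_def[symmetric] power_Suc mult.assoc)
    next
      case False
      then have "j = Suc n"
        using Suc.prems by simp
      have "q ^ Suc n * rmonom X (E j + r) = q * rmonom X (E 1) * (q ^ n * rmonom X (E n + r))"
      proof -
        have "E j + r = E 1 + (E n + r)"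
          unfolding \<open>j = Suc n\<close> by (auto simp: E_def)
        then have "rmonom X (E j + r) = rmonom X (E 1) * rmonom X (E n + r)"
          by (simp only: rmonom_times)
        then show ?thesis
          by (simp only: power_Suc mult_ac)
      qed
      then show ?thesis
        using mult_qe[OF Suc.IH[OF le_refl]] by (simp only:)
    qed
  qed
  have cancel: "f = 0" if "f \<in> restricted_polys X b" "q ^ n * f = 0" for f b n
    using that
  proof (induction n arbitrary: f b)
    case (Suc n)
    have mem: "q * f \<in> restricted_polys X (cube A K + b)"
      using restricted_polys_times[OF c_mem Suc.prems(1)] by (simp only: q_def)
    have "q ^ n * (q * f) = 0"
      using Suc.prems(2) by (simp only: power_Suc2 mult.assoc)
    then have "q * f = 0"
      using Suc.IH mem by blast
    then show ?case
      using prime q_ne c_mem Suc.prems(1) unfolding prime_on_def q_def by blast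
  qed simp
  have "hilb X (cube (insert e A) d) \<le> D * hilb X (cube A (d + d * K))" for d
  proof -
    obtain B where B: "finite B" "fs.span B = restricted_polys X (cube A (d + d * K))"
      "card B = hilb X (cube A (d + d * K))"
      by (rule restricted_polys_basis)
    \<comment> \<open>Sorting by the power of \<open>e\<close> leaves \<open>D\<close> powers, each
      with a coefficient spanned by \<open>B\<close>.\<close>
    define T where "T = (\<lambda>(j, g). rmonom X (E j) * g) ` ({..<D} \<times> B)"
    have W_T: "W d d \<subseteq> fs.span T"
    proof -
      have "rmonom X r \<in> fs.span T" if r: "r \<le> (cube A (d + d * K))(e := D - 1)" for r
      proof -
        have r_e: "r e \<le> D - 1" and r_le: "\<And>i. i \<noteq> e \<Longrightarrow> r i \<le> cube A (d + d * K) i"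
          using r unfolding le_fun_def by (metis fun_upd_same, metis fun_upd_other)
        have "r(e := 0) \<le> cube A (d + d * K)"
          using r_le by (auto simp: le_fun_def split: if_splits)
        then have mem: "rmonom X (r(e := 0)) \<in> fs.span B"
          unfolding B by (rule rmonom_mem)
        have "rmonom X (E (r e)) \<in> fs.span {rmonom X (E (r e))}"
          by (rule fs.span_base) simp
        then have "rmonom X (E (r e)) * rmonom X (r(e := 0)) \<in> fs.span T"
          using mem
        proof (rule span_times)
          fix f g assume "f \<in> {rmonom X (E (r e))}" "g \<in> B"
          moreover have "r e < D"
            using r_e \<open>D \<noteq> 0\<close> by simp
          ultimately show "f * g \<in> fs.span T"
            unfolding T_def by (intro fs.span_base image_eqI[of _ _ "(r e, g)"]) auto
        qed
        then show ?thesis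
          by (simp only: rmonom_times split)
      qed
      then show ?thesis
        unfolding W_def restricted_polys_def by (intro fs.span_minimal) auto
    qed
    have "hilb X (cube (insert e A) d) \<le> card T"
      unfolding hilb_def
    proof (rule fdim_le_card_image[where \<Phi> = "\<lambda>f. q ^ d * f"])
      show "q ^ d * (f + g) = q ^ d * f + q ^ d * g" for f g
        by (rule distrib_left)
      show "q ^ d * fscale k f = fscale k (q ^ d * f)" for k f
        by (rule fscale_times)
      show "f = 0" if "f \<in> fs.span (rmonom X ` {..cube (insert e A) d})" "q ^ d * f = 0" for f
        using cancel that unfolding restricted_polys_def by blast
      show "finite T"
        using B by (simp add: T_def)
      fix g assume "g \<in> rmonom X ` {..cube (insert e A) d}"
      then obtain r where r: "r \<le> cube (insert e A) d" and g: "g = rmonom X r"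
        by auto
      have r_le: "r i \<le> cube (insert e A) d i" for i
        using r by (simp add: le_fun_def)
      have "r e \<le> d"
        using r_le[of e] by (simp add: cube_def)
      moreover have "(r(e := 0)) i \<le> cube A d i" for i
        using r_le[of i] by (auto simp: cube_def)
      then have "r(e := 0) \<le> cube A d"
        by (rule le_funI)
      ultimately have "q ^ d * rmonom X (E (r e) + r(e := 0)) \<in> W d d"
        by (rule power_mem)
      then show "q ^ d * g \<in> fs.span T"
        using W_T unfolding g split by blast
    qed
    also have "\<dots> \<le> card ({..<D} \<times> B)"
      unfolding T_def using B by (intro card_image_le) auto
    finally show ?thesis
      using B by (simp add: card_cartesian_product)
  qed
  then show ?thesis by blast
qed

text \<open>The box count settles \<open>A = I\<close>. Adding one dependent element multiplies by a
  constant and replaces \<open>d\<close> by \<open>d + d * K\<close>; since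
  \<open>d + d * K + 1 \<le> (K + 1) * (d + 1)\<close>, only the constant changes, not the
  exponent.\<close>

lemma hilb_le_power:
  fixes X :: "('a::field ^ 'n::finite) set"
  assumes "prime_on X" "alg_indep X I" "I \<subseteq> A"
    and dep: "\<And>e. e \<in> A - I \<Longrightarrow> \<not> alg_indep X (insert e I)"
  shows "\<exists>C. \<forall>d. hilb X (cube A d) \<le> C * (d + 1) ^ card I"
proof -
  have "\<exists>C. \<forall>d. hilb X (cube (I \<union> J) d) \<le> C * (d + 1) ^ card I" if "J \<subseteq> A - I" for J
    using finite[of J] that
  proof (induction J rule: finite_induct)
    case empty
    have "hilb X (cube I d) \<le> 1 * (d + 1) ^ card I" for d
      using hilb_le[of X "cube I d"] by (simp only: card_cube mult_1)
    then show ?case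
      by (metis Un_empty_right)
  next
    case (insert e J)
    then obtain C where C: "\<And>d. hilb X (cube (I \<union> J) d) \<le> C * (d + 1) ^ card I"
      by auto
    obtain D K where DK:
      "\<And>d. hilb X (cube (insert e (I \<union> J)) d) \<le> D * hilb X (cube (I \<union> J) (d + d * K))"
      using hilb_insert_algebraic[of X I "I \<union> J" e] assms(1,2) dep insert by auto
    have "hilb X (cube (I \<union> insert e J) d) \<le> (D * C * (K + 1) ^ card I) * (d + 1) ^ card I" for d
    proof -
      have "hilb X (cube (I \<union> insert e J) d) \<le> D * hilb X (cube (I \<union> J) (d + d * K))"
        using DK by simp
      also have "\<dots> \<le> D * (C * (d + d * K + 1) ^ card I)"
        by (intro mult_left_mono C) auto
      also have "\<dots> \<le> D * (C * ((K + 1) * (d + 1)) ^ card I)"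
        by (intro mult_left_mono power_mono) auto
      finally show ?thesis
        by (simp only: power_mult_distrib mult_ac)
    qed
    then show ?case by blast
  qed
  from this[of "A - I"] show ?thesis
    using \<open>I \<subseteq> A\<close> by (simp add: Un_absorb1)
qed

text \<open>The choice \<open>d = C\<close> already refutes a larger exponent on the left.\<close>

lemma power_growth:
  fixes C :: nat
  assumes "\<And>d. (d + 1) ^ a \<le> C * (d + 1) ^ b"
  shows "a \<le> b"
proof (rule ccontr)
  assume "\<not> a \<le> b"
  then have "(C + 1) ^ Suc b \<le> (C + 1) ^ a"
    by (intro power_increasing) auto
  then have "(C + 1) ^ Suc b \<le> C * (C + 1) ^ b"
    using assms[of C] by (rule order_trans)
  moreover have "C * (C + 1) ^ b < (C + 1) ^ Suc b"
    by simp
  ultimately show False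
    by (meson not_le)
qed

text \<open>If no element of \<open>J - I\<close> could be added, \<open>I\<close> would be maximal
  in \<open>I \<union> J\<close> and bound the growth exponent by \<open>card I\<close>, while
  \<open>J\<close> forces at least \<open>card J\<close>.\<close>

lemma alg_indep_augment:
  fixes X :: "('a::field ^ 'n::finite) set"
  assumes "prime_on X" "alg_indep X I" "alg_indep X J" "card I < card J"
  shows "\<exists>e\<in>J - I. alg_indep X (insert e I)"
proof (rule ccontr)
  assume "\<not> ?thesis"
  then obtain C where C: "\<And>d. hilb X (cube (I \<union> J) d) \<le> C * (d + 1) ^ card I"
    using hilb_le_power[of X I "I \<union> J"] assms by auto
  have "(d + 1) ^ card J \<le> C * (d + 1) ^ card I" for d
    using hilb_alg_indep[OF assms(3), of d] hilb_mono[OF cube_mono, of J "I \<union> J" X d] C[of d]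
    by simp
  then show False
    using power_growth assms(4) by (metis not_le)
qed

section \<open>Algebraic matroids and joins\<close>

text \<open>Over a finite index type every exponent function has finite support, so this inverts
  \<open>lookup\<close>.\<close>

definition exp_of :: "('n::finite \<Rightarrow> nat) \<Rightarrow> 'n \<Rightarrow>\<^sub>0 nat" where
  "exp_of = Abs_poly_mapping"

lemma lookup_exp_of [simp]: "Poly_Mapping.lookup (exp_of p) = p"
  unfolding exp_of_def by (rule lookup_Abs_poly_mapping) simp

lemma exp_of_lookup [simp]: "exp_of (Poly_Mapping.lookup m) = m"
  by (simp add: exp_of_def)

lemma inj_exp_of: "inj exp_of"
  by (metis injI lookup_exp_of)

lemma eval_mpoly_superset:
  fixes f :: "('n::finite, 'a::field) mpoly"
  assumes "finite S" "Poly_Mapping.keys f \<subseteq> S"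
  shows "eval_mpoly f x = (\<Sum>m\<in>S. Poly_Mapping.lookup f m * monom_eval (Poly_Mapping.lookup m) x)"
  unfolding eval_mpoly_def monom_eval_def
  by (rule sum.mono_neutral_left) (use assms in \<open>auto simp: in_keys_iff\<close>)

lemma eval_mpoly_add:
  fixes f g :: "('n::finite, 'a::field) mpoly"
  shows "eval_mpoly (f + g) x = eval_mpoly f x + eval_mpoly g x"
proof -
  let ?S = "Poly_Mapping.keys f \<union> Poly_Mapping.keys g"
  have "Poly_Mapping.keys (f + g) \<subseteq> ?S"
    by (rule Poly_Mapping.keys_add)
  then show ?thesis
    using eval_mpoly_superset[of ?S f x] eval_mpoly_superset[of ?S g x]
      eval_mpoly_superset[of ?S "f + g" x]
    by (simp add: lookup_add distrib_right sum.distrib)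
qed

lemma eval_mpoly_single:
  "eval_mpoly (Poly_Mapping.single (exp_of p) c) x = c * monom_eval p x"
  for c :: "'a::field"
  by (subst eval_mpoly_superset[of "{exp_of p}"]) auto

lemma alg_indep_iff:
  fixes X :: "('a::field ^ 'n::finite) set"
  shows "vanishing_ideal X \<inter> polys_in E = {0} \<longleftrightarrow> alg_indep X E"
proof
  assume ideal: "vanishing_ideal X \<inter> polys_in E = {0}"
  show "alg_indep X E"
    unfolding alg_indep_def
  proof (intro allI impI)
    fix F and a :: "('n \<Rightarrow> nat) \<Rightarrow> 'a"
    assume F: "finite F" "\<forall>p\<in>F. \<forall>i. i \<notin> E \<longrightarrow> p i = 0"
      and rel: "\<forall>x\<in>X. (\<Sum>p\<in>F. a p * monom_eval p x) = 0"
    define f where "f = (\<Sum>p\<in>F. Poly_Mapping.single (exp_of p) (a p))"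
    have lookup_f: "Poly_Mapping.lookup f (exp_of q) = (if q \<in> F then a q else 0)" for q
    proof -
      have "Poly_Mapping.lookup f (exp_of q) = (\<Sum>p\<in>F. if p = q then a p else 0)"
        unfolding f_def lookup_sum lookup_single
        by (rule sum.cong) (auto simp: when_def inj_eq[OF inj_exp_of])
      then show ?thesis
        using F(1) by (simp add: sum.delta)
    qed
    have keys_f: "Poly_Mapping.lookup m \<in> F" if "m \<in> Poly_Mapping.keys f" for m
      using lookup_f[of "Poly_Mapping.lookup m"] that by (auto simp: in_keys_iff split: if_splits)
    have "f \<in> polys_in E"
      unfolding polys_in_def
    proof (clarify)
      fix m i assume "m \<in> Poly_Mapping.keys f" "i \<in> Poly_Mapping.keys m"
      then show "i \<in> E"
        using F(2) keys_f by (metis in_keys_iff)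
    qed
    moreover have "eval_mpoly f x = 0" if "x \<in> X" for x
    proof -
      have "Poly_Mapping.keys f \<subseteq> exp_of ` F"
        using keys_f by (metis exp_of_lookup image_eqI subsetI)
      then have "eval_mpoly f x = (\<Sum>m\<in>exp_of ` F. Poly_Mapping.lookup f m * monom_eval (Poly_Mapping.lookup m) x)"
        using F(1) by (intro eval_mpoly_superset) auto
      also have "\<dots> = (\<Sum>p\<in>F. a p * monom_eval p x)"
        by (subst sum.reindex) (auto intro: inj_on_subset[OF inj_exp_of] simp: lookup_f)
      finally show ?thesis
        using rel that by simp
    qed
    ultimately have "f = 0"
      using ideal unfolding vanishing_ideal_def by blast
    then show "\<forall>p\<in>F. a p = 0"
      using lookup_f by (metis lookup_zero)
  qed
next
  assume indep: "alg_indep X E"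
  have "f = 0" if f: "f \<in> vanishing_ideal X" "f \<in> polys_in E" for f
  proof -
    let ?F = "Poly_Mapping.lookup ` Poly_Mapping.keys f"
    have inj: "inj_on Poly_Mapping.lookup (Poly_Mapping.keys f)"
      by (metis inj_onI exp_of_lookup)
    have "Poly_Mapping.lookup f m = 0" if "m \<in> Poly_Mapping.keys f" for m
    proof -
      have "Poly_Mapping.lookup f (exp_of (Poly_Mapping.lookup m)) = 0"
      proof (rule alg_indepD[OF indep, of ?F "\<lambda>p. Poly_Mapping.lookup f (exp_of p)"])
        show "p i = 0" if "p \<in> ?F" "i \<notin> E" for p i
        proof -
          from that obtain m where "m \<in> Poly_Mapping.keys f" "p = Poly_Mapping.lookup m"
            by blast
          then show ?thesis
            using f(2) \<open>i \<notin> E\<close> unfolding polys_in_def by (metis (mono_tags, lifting) in_keys_iff mem_Collect_eq subsetD)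
        qed
        show "(\<Sum>p\<in>?F. Poly_Mapping.lookup f (exp_of p) * monom_eval p x) = 0" if "x \<in> X" for x
          using f(1) that eval_mpoly_superset[of "Poly_Mapping.keys f" f x]
          by (simp add: sum.reindex[OF inj] vanishing_ideal_def)
      qed (use that in auto)
      then show ?thesis by simp
    qed
    then show "f = 0"
      by (metis in_keys_iff lookup_zero poly_mapping_eqI)
  qed
  moreover have "0 \<in> vanishing_ideal X \<inter> polys_in E"
    by (simp add: vanishing_ideal_def polys_in_def eval_mpoly_def)
  ultimately show "vanishing_ideal X \<inter> polys_in E = {0}"
    by blast
qed

section \<open>Irreducibility, closures and sums of several varieties\<close>

lemma restricted_polys_eval:
  assumes "f \<in> restricted_polys X b"
  shows "\<exists>g. \<forall>x\<in>X. f x = eval_mpoly g x"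
  using assms unfolding restricted_polys_def
proof (induction rule: fs.span_induct_alt)
  case base
  have "\<forall>x\<in>X. (0 :: 'a ^ 'b \<Rightarrow> 'a) x = eval_mpoly 0 x"
    by (simp add: eval_mpoly_def)
  then show ?case by blast
next
  case (step c f h)
  then obtain g p where g: "\<forall>x\<in>X. h x = eval_mpoly g x" and p: "f = rmonom X p"
    by blast
  have "\<forall>x\<in>X. (fscale c f + h) x = eval_mpoly (Poly_Mapping.single (exp_of p) c + g) x"
    using g by (simp add: eval_mpoly_add eval_mpoly_single fscale_apply p rmonom_def)
  then show ?case by blast
qed

text \<open>If \<open>f * g = 0\<close>, then \<open>X\<close> is the union of its closed subsets
  where \<open>f\<close>, respectively \<open>g\<close>, vanishes; one of them is all of
  \<open>X\<close>.\<close>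

lemma irreducible_imp_prime_on:
  fixes X :: "('a::field ^ 'n::finite) set"
  assumes "irreducible_variety X"
  shows "prime_on X"
  unfolding prime_on_def
proof (intro allI impI)
  fix b b' f g
  assume f: "f \<in> restricted_polys X b" and g: "g \<in> restricted_polys X b'" and fg: "f * g = 0"
  obtain F where F: "X = zero_locus F"
    using assms unfolding irreducible_variety_def zariski_closed_def by blast
  obtain f' where f': "\<forall>x\<in>X. f x = eval_mpoly f' x"
    using restricted_polys_eval[OF f] by blast
  obtain g' where g': "\<forall>x\<in>X. g x = eval_mpoly g' x"
    using restricted_polys_eval[OF g] by blast
  let ?A = "zero_locus (insert f' F)" and ?B = "zero_locus (insert g' F)"
  have AB: "?A = {x \<in> X. f x = 0}" "?B = {x \<in> X. g x = 0}"
    using F f' g' unfolding zero_locus_def by auto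
  have "f x = 0 \<or> g x = 0" for x
    using fun_cong[OF fg, of x] by simp
  then have "X = ?A \<union> ?B"
    unfolding AB by blast
  then have "X = ?A \<or> X = ?B"
    using assms unfolding irreducible_variety_def zariski_closed_def by blast
  then have "(\<forall>x\<in>X. f x = 0) \<or> (\<forall>x\<in>X. g x = 0)"
    unfolding AB by blast
  then have "(\<forall>x. f x = 0) \<or> (\<forall>x. g x = 0)"
    using restricted_polys_outside f g by blast
  then show "f = 0 \<or> g = 0"
    by (simp add: fun_eq_iff)
qed

text \<open>Allows independence in the join to be tested on the plain set of sums, where the
  dimension bounds apply.\<close>

lemma vanishing_ideal_closure: "vanishing_ideal (zariski_closure S) = vanishing_ideal S"
proof
  show "vanishing_ideal (zariski_closure S) \<subseteq> vanishing_ideal S"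
    using hull_subset[of S zariski_closed] unfolding vanishing_ideal_def by blast
  show "vanishing_ideal S \<subseteq> vanishing_ideal (zariski_closure S)"
  proof
    fix f assume f: "f \<in> vanishing_ideal S"
    have "zariski_closure S \<subseteq> zero_locus {f}"
      by (rule hull_minimal) (use f in \<open>auto simp: zariski_closed_def vanishing_ideal_def zero_locus_def\<close>)
    then show "f \<in> vanishing_ideal (zariski_closure S)"
      unfolding vanishing_ideal_def zero_locus_def by blast
  qed
qed

lemma hilb_sum_le:
  fixes X :: "nat \<Rightarrow> ('a::field ^ 'n::finite) set"
  shows "hilb {\<Sum>i=1..s. x i | x. \<forall>i\<in>{1..s}. x i \<in> X i} b \<le> (\<Prod>i=1..s. hilb (X i) b)"
proof (induction s)
  case 0
  have S: "{\<Sum>i=1..0. x i | x :: nat \<Rightarrow> 'a ^ 'n. \<forall>i\<in>{1..0}. x i \<in> X i} = {0}"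
    by auto
  \<comment> \<open>The empty sum gives one point, whose functions form a line; this matches the
    empty product.\<close>
  define \<delta> :: "'a ^ 'n \<Rightarrow> 'a" where "\<delta> = (\<lambda>x. if x = 0 then 1 else 0)"
  have "rmonom {0} p = fscale (monom_eval p 0) \<delta>" for p
    by (auto simp: rmonom_def \<delta>_def fscale_apply fun_eq_iff)
  moreover have "fscale c \<delta> \<in> fs.span {\<delta>}" for c
    by (intro fs.span_scale fs.span_base) simp
  ultimately have "rmonom {0} ` {..b} \<subseteq> fs.span {\<delta>}"
    by (simp only: image_subset_iff) simp
  then have "hilb {0 :: 'a ^ 'n} b \<le> card {\<delta>}"
    unfolding hilb_def by (rule fs.dim_le_card) simp
  then show ?case
    unfolding S by simp
next
  case (Suc s)
  let ?S = "\<lambda>s. {\<Sum>i=1..s. x i | x. \<forall>i\<in>{1..s}. x i \<in> X i}"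
  have S: "?S (Suc s) = {y + z | y z. y \<in> ?S s \<and> z \<in> X (Suc s)}"
  proof (intro equalityI subsetI)
    fix v assume "v \<in> ?S (Suc s)"
    then obtain x where "v = (\<Sum>i=1..Suc s. x i)" and x: "\<forall>i\<in>{1..Suc s}. x i \<in> X i"
      by blast
    then have "v = (\<Sum>i=1..s. x i) + x (Suc s)"
      by simp
    moreover have "\<forall>i\<in>{1..s}. x i \<in> X i" "x (Suc s) \<in> X (Suc s)"
      using x by simp_all
    ultimately show "v \<in> {y + z | y z. y \<in> ?S s \<and> z \<in> X (Suc s)}"
      by blast
  next
    fix v assume "v \<in> {y + z | y z. y \<in> ?S s \<and> z \<in> X (Suc s)}"
    then obtain x z where v: "v = (\<Sum>i=1..s. x i) + z" "\<forall>i\<in>{1..s}. x i \<in> X i" "z \<in> X (Suc s)"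
      by blast
    let ?x = "x(Suc s := z)"
    have "(\<Sum>i=1..s. ?x i) = (\<Sum>i=1..s. x i)"
      by (rule sum.cong) auto
    then have "v = (\<Sum>i=1..Suc s. ?x i)"
      by (simp add: v(1))
    moreover have "?x i \<in> X i" if "i \<in> {1..Suc s}" for i
      using v(2,3) that by (cases "i = Suc s") auto
    ultimately show "v \<in> ?S (Suc s)"
      by blast
  qed
  have "hilb (?S (Suc s)) b \<le> hilb (?S s) b * hilb (X (Suc s)) b"
    unfolding S by (rule hilb_sumset)
  also have "\<dots> \<le> (\<Prod>i=1..s. hilb (X i) b) * hilb (X (Suc s)) b"
    by (intro mult_right_mono Suc.IH) simp
  finally show ?case
    by simp
qed

theorem theorem3p1:
  fixes X :: "nat \<Rightarrow> ('a::{alg_closed_field, field_char_0} ^ 'n::finite) set"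
    and s :: nat
  assumes "s \<ge> 1"
    and "\<And>i. i \<in> {1..s} \<Longrightarrow> irreducible_variety (X i)"
    and "\<And>i. i \<in> {1..s} \<Longrightarrow> affine_cone (X i)"
  shows "algebraic_matroid (join_cones s X) \<preceq>\<^sub>w matroid_union s (\<lambda>i. algebraic_matroid (X i))"
proof -
  let ?S = "{\<Sum>i=1..s. x i | x. \<forall>i\<in>{1..s}. x i \<in> X i}"
  have prime: "prime_on (X i)" if "i \<in> {1..s}" for i
    using irreducible_imp_prime_on assms(2) that by blast
  have matroid: "matroid_indep (alg_indep (X i))" if "i \<in> {1..s}" for i
  proof
    show "alg_indep (X i) {}"
      using assms(2)[OF that] by (intro alg_indep_empty) (simp add: irreducible_variety_def)
  qed (rule alg_indep_subset alg_indep_augment[OF prime[OF that]]; assumption)+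
  define r where "r i = matroid_indep.rk (alg_indep (X i))" for i
  have growth: "\<exists>C. \<forall>d. hilb (X i) (cube A d) \<le> C * (d + 1) ^ r i A" if i: "i \<in> {1..s}" for i A
  proof -
    interpret matroid_indep "alg_indep (X i)"
      by (rule matroid[OF i])
    obtain I where I: "I \<subseteq> A" "alg_indep (X i) I" "card I = rk A"
      by (rule rk_attained)
    \<comment> \<open>A set attaining the rank is maximal independent in \<open>A\<close>, as the
      growth bound demands.\<close>
    have "\<not> alg_indep (X i) (insert e I)" if "e \<in> A - I" for e
    proof
      assume "alg_indep (X i) (insert e I)"
      then have "card (insert e I) \<le> rk A"
        using I that by (intro card_le_rk) auto
      then show False
        using I that by simp
    qed
    then show ?thesis
      using hilb_le_power[OF prime[OF i] I(2,1)] I(3) by (simp add: r_def)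
  qed
  have union: "E \<in> indeps (matroid_union s (\<lambda>i. algebraic_matroid (X i)))"
    if E: "E \<in> indeps (algebraic_matroid (join_cones s X))" for E
  proof -
    have indep: "alg_indep ?S A" if "A \<subseteq> E" for A
      using E that alg_indep_subset
      by (auto simp: algebraic_matroid_def join_cones_def vanishing_ideal_closure alg_indep_iff)
    have rado: "card A \<le> (\<Sum>i\<in>{1..s}. r i A)" if "A \<subseteq> E" for A
    proof -
      have "\<exists>C. \<forall>i\<in>{1..s}. \<forall>d. hilb (X i) (cube A d) \<le> C i * (d + 1) ^ r i A"
        using growth by (intro bchoice) blast
      then obtain C where C: "\<And>i d. i \<in> {1..s} \<Longrightarrow> hilb (X i) (cube A d) \<le> C i * (d + 1) ^ r i A"
        by blast
      \<comment> \<open>Independence in the join makes the left side an exact dimension;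
        submultiplicativity bounds it by the growth of the factors, so comparing exponents gives the
        rank inequality.\<close>
      have "(d + 1) ^ card A \<le> (\<Prod>i=1..s. C i) * (d + 1) ^ (\<Sum>i=1..s. r i A)" for d
      proof -
        have "(d + 1) ^ card A = hilb ?S (cube A d)"
          using hilb_alg_indep[OF indep[OF that]] by simp
        also have "\<dots> \<le> (\<Prod>i=1..s. hilb (X i) (cube A d))"
          by (rule hilb_sum_le)
        also have "\<dots> \<le> (\<Prod>i=1..s. C i * (d + 1) ^ r i A)"
          using C by (intro prod_mono) auto
        finally show ?thesis
          by (simp only: prod.distrib power_sum)
      qed
      then show ?thesis
        by (rule power_growth)
    qed
    have "\<exists>I. (\<forall>i\<in>{1..s}. r i (I i) = card (I i)) \<and> (\<Union>i\<in>{1..s}. I i) = E"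
    \<comment> \<open>Initially every element may go to every part, so the rank condition is exactly
      \<open>rado\<close>.\<close>
    proof (rule matroid_partition[where S = "\<lambda>_. {1..s}"])
      show "card A \<le> (\<Sum>i\<in>{1..s}. r i {e \<in> A. i \<in> {1..s}})" if "A \<subseteq> E" for A
        using rado[OF that] by simp
      show "r i A \<le> r i B" if "i \<in> {1..s}" "A \<subseteq> B" for i A B
        unfolding r_def by (rule matroid_indep.rk_mono[OF matroid]; fact)
      show "r i (A \<union> B) + r i (A \<inter> B) \<le> r i A + r i B" if "i \<in> {1..s}" for i A B
        unfolding r_def by (rule matroid_indep.rk_submodular[OF matroid]) fact
      show "r i A \<le> card A" if "i \<in> {1..s}" for i A
        unfolding r_def by (rule matroid_indep.rk_le_card[OF matroid]) fact
    qed simp_all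
    then obtain I where I: "\<And>i. i \<in> {1..s} \<Longrightarrow> r i (I i) = card (I i)" "(\<Union>i\<in>{1..s}. I i) = E"
      by blast
    have "alg_indep (X i) (I i)" if "i \<in> {1..s}" for i
      using matroid_indep.ind_if_rk_eq_card[OF matroid[OF that]] I(1)[OF that] by (simp add: r_def)
    then have "\<forall>i\<in>{1..s}. I i \<in> indeps (algebraic_matroid (X i))"
      by (simp add: algebraic_matroid_def alg_indep_iff)
    then show ?thesis
      using I(2)[symmetric] unfolding matroid_union_def by (simp, blast)
  qed
  \<comment> \<open>For \<open>s = 0\<close> the union of ground sets would be empty.\<close>
  have "ground (matroid_union s (\<lambda>i. algebraic_matroid (X i))) = UNIV"
    using \<open>s \<ge> 1\<close> by (auto simp: matroid_union_def algebraic_matroid_def)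
  moreover have "ground (algebraic_matroid (join_cones s X)) = UNIV"
    by (simp add: algebraic_matroid_def)
  ultimately show ?thesis
    using union unfolding weak_le_def dependents_def by blast
qed

end
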